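(* Let $f^0\ge 0$ be the discrete initial condition, and let $f^1$ be the second starting value, calculated with the Euler scheme $$(I-\delta t\,A)f^m=f^{m-1}+\delta t\,Q(f^{m-1};\bar\alpha)$$ with an appropriate time step, such that $\xi f^1-f^0\ge 0$, for $1<\xi<3$. Then the BDF2 scheme $$M f^{m+1}=4f^m-f^{m-1}+\delta t\,Q(f^m;\bar\alpha),\qquad M=3I-2\,\delta t\,A,$$ for the Kolmogorov forward equation, defined in the periodic domain $\Omega_h$, is positive preserving for the solution $f^m$ with $m>1$, i.e. $f^m\ge 0$ for $m>1$.
   Context: Continuous problem. $\Omega=[\Omega_a,\Omega_b]$ is an interval with its end points identified (a torus), $b\in\mathbb{R}$, $\sigma^2>0$, $B=-b$, $C=\sigma^2/2$. The Kolmogorov forward (Fokker-Planck) equation for a probability density $f(x,t)$, $t\in[0,T]$, with periodic boundary conditions and initial condition $f(x,0)=f_0(x)$, is $$\partial_t f(x,t)=\partial_x\big(B f(x,t)+C\,\partial_x f(x,t)\big)+\int_\Omega\sum_{j=1}^{N_\Theta}\alpha_j\,(f(x+s,t)-f(x,t))\,\Theta_j(s)\,ds .$$ Here $\bar\alpha=(\alpha_1,\dots,\alpha_{N_\Theta})$ with $\alpha_j\ge0$. With $\Delta=(\Omega_b-\Omega_a)/N_\Theta$ and $\theta_j=\Omega_a+\Delta(j-1)$, $\Theta_j$ is the triangular (hat) function $\Theta_j(s)=1+(s-\theta_j)/\Delta$ on $[\theta_j-\Delta,\theta_j]$, $\Theta_j(s)=1-(s-\theta_j)/\Delta$ on $[\theta_j,\theta_j+\Delta]$,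 zero elsewhere, extended periodically ($\Theta_1\equiv\Theta_{N_\Theta+1}$). Grids. The space grid $\Omega_h$ consists of $x_i=\Omega_a+ih$, $i=0,\dots,N$, $h=(\Omega_b-\Omega_a)/N$, with $x_0$ and $x_N$ identified. The time grid is $t_m=m\,\delta t$, $m=0,\dots,N_T$, $\delta t=T/N_T$. $f_i^m$ approximates $f(x_i,t_m)$, $f^m=(f_1^m,\dots,f_N^m)^\top\in\mathbb{R}^N$, and the discrete initial condition is $f^0_i=f_{0,i}$ (the grid values of $f_0$). Vector inequalities are componentwise. Matrix $A$ (Chang-Cooper discretization of $f\mapsto\partial_x(Bf+C\partial_xf)$). Let $\omega=\exp(hB/C)$ and $\beta=B/(\omega-1)$ (read as its limit $C/h$ if $B=0$). The $N\times N$ matrix $A$ has entries $A_{i,i}=-\beta(1+\omega)/h$, $A_{i,i-1}=\beta/h$, $A_{i,i+1}=\omega\beta/h$, $A_{1,N}=\beta/h$, $A_{N,1}=\omega\beta/h$, and all other entries are $0$. $I$ is the identity matrix. Jump term (mid-point quadrature). With $s_k=x_k\in\Omega_h$ and $\theta_{jk}=\Theta_j(s_k)$, the vector $Q(f^m;\bar\alpha)$ has components $$Q(f_i^m;\bar\alpha)=h\sum_{j=1}^{N_\Theta}\alpha_j\sum_{k=1}^N\hat f_{ik}^m\,\theta_{jk}-a f_i^m,\qquad a=h\sum_{j=1}^{N_\Theta}\alpha_j\sum_{k=1}^N\theta_{jk},$$ where $\hat f_{ik}^m\approx f(x_i+s_k,t_m)$ is the grid function $f^m$ translated by $s_k$ and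 continued by periodicity, so that for each $k$ the values $(\hat f_{ik}^m)_{i=1}^N$ are a cyclic shift of $(f_i^m)_{i=1}^N$. The BDF2 scheme needs the two starting vectors $f^0,f^1$; the Euler scheme used to produce $f^1$ may be run with a time step smaller than the $\delta t$ of the BDF2 scheme.
   Formalization: Positivity is shown for sufficiently small BDF2 time steps: δt must not exceed some threshold depending only on the problem data, space grid and ξ; without such a bound the claim fails. Also N ≥ 3 is assumed so that the entries of A are consistent. *)

theory Defs
  imports Complex_Main "Jordan_Normal_Form.Matrix"
begin

text \<open>Vectors are indexed from 0: component \<open>i\<close> of a grid function in \<open>carrier_vec N\<close> is its value at
  \<open>grid_point \<Omega>\<^sub>a h (i + 1)\<close>. The end points \<open>grid_point \<Omega>\<^sub>a h 0\<close> and \<open>grid_point \<Omega>\<^sub>a h N\<close> are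
  identified.\<close>

definition grid_point :: "real \<Rightarrow> real \<Rightarrow> nat \<Rightarrow> real" where
  "grid_point \<Omega>\<^sub>a h i = \<Omega>\<^sub>a + real i * h"

definition cc_omega :: "real \<Rightarrow> real \<Rightarrow> real \<Rightarrow> real" where
  "cc_omega h B C = exp (h * B / C)"

text \<open>For \<open>B = 0\<close> the quotient is replaced by its limit.\<close>

definition cc_beta :: "real \<Rightarrow> real \<Rightarrow> real \<Rightarrow> real" where
  "cc_beta h B C = (if B = 0 then C / h else B / (cc_omega h B C - 1))"

text \<open>The Chang-Cooper matrix for \<open>f \<mapsto> (B f + C f')'\<close> with periodic boundary conditions. The
  three bands are disjoint only for \<open>N \<ge> 3\<close>.\<close>

definition chang_cooper :: "nat \<Rightarrow> real \<Rightarrow> real \<Rightarrow> real \<Rightarrow> real mat" where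
  "chang_cooper N h B C = mat N N (\<lambda>(i, j).
     if j = i then - cc_beta h B C * (1 + cc_omega h B C) / h
     else if i = j + 1 \<or> (i = 0 \<and> j = N - 1) then cc_beta h B C / h
     else if j = i + 1 \<or> (i = N - 1 \<and> j = 0) then cc_omega h B C * cc_beta h B C / h
     else 0)"

definition hat :: "real \<Rightarrow> real \<Rightarrow> real" where
  "hat \<Delta> t = (if - \<Delta> \<le> t \<and> t \<le> 0 then 1 + t / \<Delta>
              else if 0 \<le> t \<and> t \<le> \<Delta> then 1 - t / \<Delta>
              else 0)"

text \<open>Periodic extension of the hat function centred at \<open>\<theta>\<^sub>j = \<Omega>\<^sub>a + \<Delta> (j - 1)\<close>, as the sum of its
  translates by multiples of the period. The sum is restricted to the finitely many translates that
  do not vanish at \<open>s\<close>; for \<open>N\<^sub>\<Theta> \<ge> 2\<close> there is at most one.\<close>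

definition hat_basis :: "real \<Rightarrow> real \<Rightarrow> nat \<Rightarrow> nat \<Rightarrow> real \<Rightarrow> real" where
  "hat_basis \<Omega>\<^sub>a \<Omega>\<^sub>b N\<^sub>\<Theta> j s =
     (let \<Delta> = (\<Omega>\<^sub>b - \<Omega>\<^sub>a) / real N\<^sub>\<Theta>;
          \<theta> = \<Omega>\<^sub>a + \<Delta> * (real j - 1);
          t = (\<lambda>p::int. s - \<theta> + of_int p * (\<Omega>\<^sub>b - \<Omega>\<^sub>a))
      in \<Sum>p | \<bar>t p\<bar> < \<Delta>. hat \<Delta> (t p))"

definition jump_rate ::
  "real \<Rightarrow> real \<Rightarrow> nat \<Rightarrow> nat \<Rightarrow> real \<Rightarrow> (nat \<Rightarrow> real) \<Rightarrow> real" where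
  "jump_rate \<Omega>\<^sub>a \<Omega>\<^sub>b N N\<^sub>\<Theta> h \<alpha> =
     h * (\<Sum>j = 1..N\<^sub>\<Theta>. \<alpha> j * (\<Sum>k = 1..N. hat_basis \<Omega>\<^sub>a \<Omega>\<^sub>b N\<^sub>\<Theta> j (grid_point \<Omega>\<^sub>a h k)))"

text \<open>Translation by \<open>s\<^sub>k = grid_point \<Omega>\<^sub>a h k\<close> is realised on the grid as a cyclic shift by \<open>\<rho> k\<close>
  positions, where \<open>\<rho> k * h\<close> equals \<open>s\<^sub>k\<close> if \<open>s\<^sub>k\<close> is a multiple of \<open>h\<close>, and otherwise is one of the
  two multiples of \<open>h\<close> adjacent to \<open>s\<^sub>k\<close>.\<close>

definition grid_translation :: "real \<Rightarrow> real \<Rightarrow> nat \<Rightarrow> (nat \<Rightarrow> int) \<Rightarrow> bool" where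
  "grid_translation \<Omega>\<^sub>a h N \<rho> \<longleftrightarrow>
     (\<forall>k\<in>{1..N}. \<bar>of_int (\<rho> k) * h - grid_point \<Omega>\<^sub>a h k\<bar> < h)"

definition cyclic_shift :: "int \<Rightarrow> real vec \<Rightarrow> real vec" where
  "cyclic_shift r f = vec (dim_vec f) (\<lambda>i. f $ nat ((int i + r) mod int (dim_vec f)))"

definition jump_term ::
  "real \<Rightarrow> real \<Rightarrow> nat \<Rightarrow> nat \<Rightarrow> real \<Rightarrow> (nat \<Rightarrow> int) \<Rightarrow> (nat \<Rightarrow> real) \<Rightarrow> real vec \<Rightarrow> real vec"
where
  "jump_term \<Omega>\<^sub>a \<Omega>\<^sub>b N N\<^sub>\<Theta> h \<rho> \<alpha> f = vec N (\<lambda>i.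
     h * (\<Sum>j = 1..N\<^sub>\<Theta>. \<alpha> j *
            (\<Sum>k = 1..N. cyclic_shift (\<rho> k) f $ i * hat_basis \<Omega>\<^sub>a \<Omega>\<^sub>b N\<^sub>\<Theta> j (grid_point \<Omega>\<^sub>a h k)))
     - jump_rate \<Omega>\<^sub>a \<Omega>\<^sub>b N N\<^sub>\<Theta> h \<alpha> * f $ i)"

definition euler_scheme ::
  "nat \<Rightarrow> real mat \<Rightarrow> (real vec \<Rightarrow> real vec) \<Rightarrow> real \<Rightarrow> nat \<Rightarrow> (nat \<Rightarrow> real vec) \<Rightarrow> bool" where
  "euler_scheme N A Q \<tau> n g \<longleftrightarrow>
     (\<forall>m\<le>n. g m \<in> carrier_vec N) \<and>
     (\<forall>m\<in>{1..n}. (1\<^sub>m N - \<tau> \<cdot>\<^sub>m A) *\<^sub>v g m = g (m - 1) + \<tau> \<cdot>\<^sub>v Q (g (m - 1)))"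

text \<open>The jump term carries the factor \<open>\<delta>t\<close>, not \<open>2 * \<delta>t\<close>.\<close>

definition bdf2_scheme ::
  "nat \<Rightarrow> real mat \<Rightarrow> (real vec \<Rightarrow> real vec) \<Rightarrow> real \<Rightarrow> nat \<Rightarrow> (nat \<Rightarrow> real vec) \<Rightarrow> bool" where
  "bdf2_scheme N A Q \<delta>t N\<^sub>T f \<longleftrightarrow>
     (\<forall>m\<le>N\<^sub>T. f m \<in> carrier_vec N) \<and>
     (\<forall>m\<in>{1..<N\<^sub>T}. (3 \<cdot>\<^sub>m 1\<^sub>m N - (2 * \<delta>t) \<cdot>\<^sub>m A) *\<^sub>v f (m + 1)
                   = 4 \<cdot>\<^sub>v f m - f (m - 1) + \<delta>t \<cdot>\<^sub>v Q (f m))"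

end

theory Submission
  imports Defs
begin

text \<open>
  The matrix \<open>A\<close> is the generator of a continuous-time random walk on the discrete circle: its
  off-diagonal entries are non-negative and its rows sum to zero. Hence \<open>3 I - 2 \<delta>t A\<close> obeys a
  discrete minimum principle and has a non-negative inverse (\<open>generator_resolvent_nonneg\<close>). The
  right-hand side \<open>4 f\<^sup>m - f\<^sup>m\<^sup>-\<^sup>1 + \<delta>t Q(f\<^sup>m)\<close> of BDF2 contains a negative multiple of \<open>f\<^sup>m\<^sup>-\<^sup>1\<close>, so
  positivity alone does not propagate. What propagates is positivity together with the growth
  bound \<open>f\<^sup>m\<^sup>-\<^sup>1 \<le> \<xi> f\<^sup>m\<close>.

  Two facts control the remaining terms on a non-negative vector \<open>x\<close>: the gains in \<open>Q x\<close> and in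
  \<open>A x\<close> are non-negative and the losses are multiples of \<open>x\<close>, so \<open>Q x \<ge> - a x\<close> and \<open>A x \<ge> - d x\<close>
  with \<open>- d\<close> the diagonal entry of \<open>A\<close>. With \<open>M = 3 I - 2 \<delta>t A\<close>, the growth bound at \<open>m\<close> yields
  \<open>M f\<^sup>m\<^sup>+\<^sup>1 \<ge> (4 - \<xi> - a \<delta>t) f\<^sup>m\<close> and
  \<open>M (\<xi> f\<^sup>m\<^sup>+\<^sup>1 - f\<^sup>m) \<ge> (\<xi> (4 - \<xi>) - 3 - \<delta>t (\<xi> a + 2 d)) f\<^sup>m\<close>.
  Since \<open>\<xi> (4 - \<xi>) - 3 = (\<xi> - 1) (3 - \<xi>)\<close> is positive exactly for \<open>1 < \<xi> < 3\<close>, both coefficients are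
  non-negative as soon as \<open>\<delta>t (\<xi> a + 2 d) \<le> (\<xi> - 1) (3 - \<xi>)\<close>, and inverting \<open>M\<close> passes both
  properties on to \<open>f\<^sup>m\<^sup>+\<^sup>1\<close> (\<open>bdf2_step_nonneg\<close>). This threshold does not depend on \<open>m\<close>, so
  the argument repeats.
\<close>

section \<open>Generator matrices and their resolvents\<close>

lemma zero_le_vec_iff:
  fixes x :: "real vec"
  assumes "x \<in> carrier_vec N"
  shows "0\<^sub>v N \<le> x \<longleftrightarrow> (\<forall>i<N. 0 \<le> x $ i)"
  using assms by (auto simp: less_eq_vec_def)

definition generator_mat :: "nat \<Rightarrow> real mat \<Rightarrow> bool" where
  "generator_mat N A \<longleftrightarrow> A \<in> carrier_mat N N \<and>
     (\<forall>i<N. \<forall>j<N. i \<noteq> j \<longrightarrow> 0 \<le> A $$ (i, j)) \<and>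
     (\<forall>i<N. (\<Sum>j<N. A $$ (i, j)) = 0)"

lemma mult_mat_vec_index_sum:
  fixes A :: "'a::semiring_0 mat"
  assumes "A \<in> carrier_mat N N" "x \<in> carrier_vec N" "i < N"
  shows "(A *\<^sub>v x) $ i = (\<Sum>j<N. A $$ (i, j) * x $ j)"
  using assms by (auto simp: scalar_prod_def atLeast0LessThan)

lemma shifted_mult_mat_vec_index:
  fixes A :: "real mat"
  assumes "A \<in> carrier_mat N N" "x \<in> carrier_vec N" "i < N"
  shows "((c \<cdot>\<^sub>m 1\<^sub>m N - s \<cdot>\<^sub>m A) *\<^sub>v x) $ i = c * x $ i - s * (A *\<^sub>v x) $ i"
proof -
  have "c \<cdot>\<^sub>m 1\<^sub>m N - s \<cdot>\<^sub>m A \<in> carrier_mat N N"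
    using assms by (intro minus_carrier_mat smult_carrier_mat)
  then have "((c \<cdot>\<^sub>m 1\<^sub>m N - s \<cdot>\<^sub>m A) *\<^sub>v x) $ i
      = (\<Sum>j<N. (c \<cdot>\<^sub>m 1\<^sub>m N - s \<cdot>\<^sub>m A) $$ (i, j) * x $ j)"
    using assms by (simp only: mult_mat_vec_index_sum)
  also have "\<dots> = (\<Sum>j<N. (if j = i then c * x $ j else 0) - s * (A $$ (i, j) * x $ j))"
    using assms by (intro sum.cong) (auto simp: algebra_simps)
  also have "\<dots> = c * x $ i - s * (\<Sum>j<N. A $$ (i, j) * x $ j)"
    using assms by (simp add: sum_subtractf sum_distrib_left)
  also have "\<dots> = c * x $ i - s * (A *\<^sub>v x) $ i"
    using assms by (simp only: mult_mat_vec_index_sum)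
  finally show ?thesis .
qed

lemma generator_diag_lower_bound:
  assumes "generator_mat N A" "x \<in> carrier_vec N" "i < N" "\<And>j. j < N \<Longrightarrow> 0 \<le> x $ j"
  shows "A $$ (i, i) * x $ i \<le> (A *\<^sub>v x) $ i"
proof -
  have "(\<Sum>j\<in>{i}. A $$ (i, j) * x $ j) \<le> (\<Sum>j<N. A $$ (i, j) * x $ j)"
    by (rule sum_mono2) (use assms in \<open>auto simp: generator_mat_def\<close>)
  then show ?thesis
    using assms mult_mat_vec_index_sum[of A N x i] by (simp add: generator_mat_def)
qed

text \<open>At an index \<open>i\<close> where \<open>x\<close> is minimal, zero row sums give
  \<open>(A x) $ i = (\<Sum>j. A $$ (i, j) * (x $ j - x $ i)) \<ge> 0\<close>, so \<open>c * x $ i\<close> dominates the \<open>i\<close>-th component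
  of \<open>(c I - s A) x\<close>.\<close>

lemma generator_resolvent_nonneg:
  assumes gen: "generator_mat N A" and x: "x \<in> carrier_vec N" and "c > 0" "s \<ge> 0"
    and rhs: "\<And>i. i < N \<Longrightarrow> 0 \<le> ((c \<cdot>\<^sub>m 1\<^sub>m N - s \<cdot>\<^sub>m A) *\<^sub>v x) $ i"
    and "k < N"
  shows "0 \<le> x $ k"
proof -
  have A: "A \<in> carrier_mat N N"
    using gen by (simp add: generator_mat_def)
  obtain i where i: "i < N" and least: "\<And>j. j < N \<Longrightarrow> x $ i \<le> x $ j"
    using ex_min_if_finite[of "(\<lambda>j. x $ j) ` {..<N}"] \<open>k < N\<close> by force
  have "(A *\<^sub>v x) $ i = (\<Sum>j<N. A $$ (i, j) * x $ j) - (\<Sum>j<N. A $$ (i, j)) * x $ i"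
    using gen i mult_mat_vec_index_sum[OF A x i] by (simp add: generator_mat_def)
  also have "\<dots> = (\<Sum>j<N. A $$ (i, j) * (x $ j - x $ i))"
    by (simp add: sum_distrib_right sum_subtractf right_diff_distrib)
  also have "\<dots> \<ge> 0"
  proof (rule sum_nonneg)
    fix j assume "j \<in> {..<N}"
    then show "0 \<le> A $$ (i, j) * (x $ j - x $ i)"
      using gen i least[of j] by (cases "j = i") (auto simp: generator_mat_def)
  qed
  finally have "0 \<le> s * (A *\<^sub>v x) $ i"
    using \<open>s \<ge> 0\<close> by simp
  moreover have "0 \<le> c * x $ i - s * (A *\<^sub>v x) $ i"
    using rhs[OF i] shifted_mult_mat_vec_index[OF A x i, of c s] by simp
  ultimately have "0 \<le> c * x $ i"
    by linarith
  then show ?thesis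
    using \<open>c > 0\<close> least[OF \<open>k < N\<close>] by (simp add: zero_le_mult_iff)
qed

section \<open>One step of BDF2\<close>

text \<open>Here \<open>w\<close>, \<open>x\<close>, \<open>y\<close> are three successive iterates and \<open>q\<close> is the jump term at \<open>x\<close>. The condition
  on \<open>\<delta>t\<close> makes the lower bound for \<open>M (\<xi> y - x)\<close> non-negative; the other lower bound follows, since
  the condition amounts to \<open>\<xi> (4 - \<xi> - a \<delta>t) \<ge> 3 + 2 \<delta>t d\<close>.\<close>

lemma bdf2_step_nonneg:
  assumes gen: "generator_mat N A" and diag: "\<And>i. i < N \<Longrightarrow> - d \<le> A $$ (i, i)" and "d \<ge> 0"
    and carrier: "w \<in> carrier_vec N" "x \<in> carrier_vec N" "y \<in> carrier_vec N" "q \<in> carrier_vec N"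
    and xnonneg: "\<And>i. i < N \<Longrightarrow> 0 \<le> x $ i"
    and growth: "\<And>i. i < N \<Longrightarrow> w $ i \<le> \<xi> * x $ i"
    and loss: "\<And>i. i < N \<Longrightarrow> - a * x $ i \<le> q $ i"
    and "\<xi> > 0" "\<delta>t \<ge> 0" and small: "\<delta>t * (\<xi> * a + 2 * d) \<le> (\<xi> - 1) * (3 - \<xi>)"
    and step: "(3 \<cdot>\<^sub>m 1\<^sub>m N - (2 * \<delta>t) \<cdot>\<^sub>m A) *\<^sub>v y = 4 \<cdot>\<^sub>v x - w + \<delta>t \<cdot>\<^sub>v q"
    and "k < N"
  shows "0 \<le> y $ k" and "x $ k \<le> \<xi> * y $ k"
proof -
  define M where "M = 3 \<cdot>\<^sub>m 1\<^sub>m N - (2 * \<delta>t) \<cdot>\<^sub>m A"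
  have A: "A \<in> carrier_mat N N"
    using gen by (simp add: generator_mat_def)
  have M: "M \<in> carrier_mat N N"
    unfolding M_def using A by (intro minus_carrier_mat smult_carrier_mat)
  have My: "(4 - \<xi> - \<delta>t * a) * x $ i \<le> (M *\<^sub>v y) $ i" if "i < N" for i
  proof -
    have "(M *\<^sub>v y) $ i = 4 * x $ i - w $ i + \<delta>t * q $ i"
      using step that carrier by (simp add: M_def)
    moreover have "\<delta>t * (- a * x $ i) \<le> \<delta>t * q $ i"
      using loss[OF that] \<open>\<delta>t \<ge> 0\<close> by (rule mult_left_mono)
    ultimately show ?thesis
      using growth[OF that] by (simp add: algebra_simps)
  qed
  have coeff: "3 + 2 * \<delta>t * d \<le> \<xi> * (4 - \<xi> - \<delta>t * a)"
    using small by (simp add: algebra_simps)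
  then have "0 \<le> \<xi> * (4 - \<xi> - \<delta>t * a)"
    using mult_nonneg_nonneg[OF \<open>\<delta>t \<ge> 0\<close> \<open>d \<ge> 0\<close>] by linarith
  then have "0 \<le> 4 - \<xi> - \<delta>t * a"
    using \<open>\<xi> > 0\<close> by (simp add: zero_le_mult_iff)
  then have "0 \<le> (M *\<^sub>v y) $ i" if "i < N" for i
    using My[OF that] xnonneg[OF that] by (meson mult_nonneg_nonneg order_trans)
  then show "0 \<le> y $ k"
    using generator_resolvent_nonneg[OF gen, of y 3 "2 * \<delta>t"] carrier \<open>\<delta>t \<ge> 0\<close> \<open>k < N\<close>
    by (simp add: M_def)
  have "0 \<le> (M *\<^sub>v (\<xi> \<cdot>\<^sub>v y - x)) $ i" if "i < N" for i
  proof -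
    have "- d * x $ i \<le> A $$ (i, i) * x $ i"
      using diag[OF that] xnonneg[OF that] by (rule mult_right_mono)
    also have "\<dots> \<le> (A *\<^sub>v x) $ i"
      using generator_diag_lower_bound[OF gen] carrier that xnonneg by blast
    finally have "2 * \<delta>t * (- d * x $ i) \<le> 2 * \<delta>t * (A *\<^sub>v x) $ i"
      using \<open>\<delta>t \<ge> 0\<close> by (intro mult_left_mono) auto
    moreover have "(M *\<^sub>v x) $ i = 3 * x $ i - 2 * \<delta>t * (A *\<^sub>v x) $ i"
      unfolding M_def using shifted_mult_mat_vec_index[OF A _ that] carrier by blast
    ultimately have Mx: "(M *\<^sub>v x) $ i \<le> (3 + 2 * \<delta>t * d) * x $ i"
      by (simp add: algebra_simps)
    also have "\<dots> \<le> \<xi> * (4 - \<xi> - \<delta>t * a) * x $ i"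
      using coeff xnonneg[OF that] by (rule mult_right_mono)
    also have "\<dots> = \<xi> * ((4 - \<xi> - \<delta>t * a) * x $ i)"
      by (simp only: mult.assoc)
    also have "\<dots> \<le> \<xi> * (M *\<^sub>v y) $ i"
      using My[OF that] \<open>\<xi> > 0\<close> by (intro mult_left_mono) auto
    finally have "(M *\<^sub>v x) $ i \<le> \<xi> * (M *\<^sub>v y) $ i" .
    moreover have "M *\<^sub>v (\<xi> \<cdot>\<^sub>v y - x) = \<xi> \<cdot>\<^sub>v (M *\<^sub>v y) - M *\<^sub>v x"
      using M carrier by (simp add: mult_minus_distrib_mat_vec[of _ N N] mult_mat_vec[of _ N N])
    ultimately show ?thesis
      using M that by simp
  qed
  then have "0 \<le> (\<xi> \<cdot>\<^sub>v y - x) $ k"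
    using generator_resolvent_nonneg[OF gen, of "\<xi> \<cdot>\<^sub>v y - x" 3 "2 * \<delta>t"] carrier \<open>\<delta>t \<ge> 0\<close> \<open>k < N\<close>
    by (simp add: M_def)
  then show "x $ k \<le> \<xi> * y $ k"
    using carrier \<open>k < N\<close> by simp
qed

section \<open>The jump term\<close>

lemma hat_basis_nonneg: "0 \<le> hat_basis \<Omega>\<^sub>a \<Omega>\<^sub>b N\<^sub>\<Theta> j s"
  unfolding hat_basis_def Let_def
proof (rule sum_nonneg)
  fix p :: int
  let ?\<Delta> = "(\<Omega>\<^sub>b - \<Omega>\<^sub>a) / real N\<^sub>\<Theta>"
  let ?t = "s - (\<Omega>\<^sub>a + ?\<Delta> * (real j - 1)) + of_int p * (\<Omega>\<^sub>b - \<Omega>\<^sub>a)"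
  have hat: "0 \<le> hat \<Delta> t" if "\<bar>t\<bar> < \<Delta>" for \<Delta> t
    using that by (auto simp: hat_def field_simps)
  assume "p \<in> {p. \<bar>s - (\<Omega>\<^sub>a + ?\<Delta> * (real j - 1)) + of_int p * (\<Omega>\<^sub>b - \<Omega>\<^sub>a)\<bar> < ?\<Delta>}"
  then show "0 \<le> hat ?\<Delta> ?t"
    by (intro hat) blast
qed

lemma jump_rate_nonneg:
  assumes "h \<ge> 0" "\<forall>j\<in>{1..N\<^sub>\<Theta>}. \<alpha> j \<ge> 0"
  shows "0 \<le> jump_rate \<Omega>\<^sub>a \<Omega>\<^sub>b N N\<^sub>\<Theta> h \<alpha>"
  unfolding jump_rate_def using assms
  by (intro mult_nonneg_nonneg sum_nonneg hat_basis_nonneg) auto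

lemma jump_term_lower_bound:
  assumes "h \<ge> 0" "\<forall>j\<in>{1..N\<^sub>\<Theta>}. \<alpha> j \<ge> 0" "f \<in> carrier_vec N" "i < N"
    and nonneg: "\<And>i. i < N \<Longrightarrow> 0 \<le> f $ i"
  shows "- jump_rate \<Omega>\<^sub>a \<Omega>\<^sub>b N N\<^sub>\<Theta> h \<alpha> * f $ i \<le> jump_term \<Omega>\<^sub>a \<Omega>\<^sub>b N N\<^sub>\<Theta> h \<rho> \<alpha> f $ i"
proof -
  have shift: "0 \<le> cyclic_shift r f $ i" for r
  proof -
    have "nat ((int i + r) mod int N) < N"
      using \<open>i < N\<close> by (simp add: nat_less_iff)
    then show ?thesis
      using assms by (simp add: cyclic_shift_def)
  qed
  have "0 \<le> h * (\<Sum>j = 1..N\<^sub>\<Theta>. \<alpha> j *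
    (\<Sum>k = 1..N. cyclic_shift (\<rho> k) f $ i * hat_basis \<Omega>\<^sub>a \<Omega>\<^sub>b N\<^sub>\<Theta> j (grid_point \<Omega>\<^sub>a h k)))"
    using assms shift by (intro mult_nonneg_nonneg sum_nonneg hat_basis_nonneg) auto
  then show ?thesis
    using \<open>i < N\<close> by (simp add: jump_term_def)
qed

section \<open>The Chang-Cooper matrix\<close>

lemma cc_beta_pos:
  assumes "h > 0" "C > 0"
  shows "0 < cc_beta h B C"
proof (cases B "0::real" rule: linorder_cases)
  case less
  then have "h * B / C < 0"
    using assms by (simp add: divide_neg_pos mult_pos_neg)
  then show ?thesis
    using less by (simp add: cc_beta_def cc_omega_def divide_neg_neg)
next
  case equal
  then show ?thesis
    using assms by (simp add: cc_beta_def)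
next
  case greater
  then have "0 < h * B / C"
    using assms by simp
  then show ?thesis
    using greater by (simp add: cc_beta_def cc_omega_def)
qed

text \<open>Since \<open>B\<close> and \<open>C\<close> are constant in space, the weights towards the two neighbours are the same in
  every row, and the rows sum to zero just as the columns do. For \<open>N \<ge> 3\<close> a grid point and its two
  cyclic neighbours are distinct, so each row is a sum of three single-entry rows.\<close>

lemma generator_mat_chang_cooper:
  assumes "N \<ge> 3" "h > 0" "C > 0"
  shows "generator_mat N (chang_cooper N h B C)"
  unfolding generator_mat_def
proof (intro conjI allI impI)
  define \<beta> \<omega> where "\<beta> = cc_beta h B C" and "\<omega> = cc_omega h B C"
  have pos: "\<beta> > 0" "\<omega> > 0"
    using cc_beta_pos assms by (auto simp: \<beta>_def \<omega>_def cc_omega_def)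
  let ?A = "chang_cooper N h B C"
  show "?A \<in> carrier_mat N N"
    by (simp add: chang_cooper_def)
  show "0 \<le> ?A $$ (i, j)" if "i < N" "j < N" "i \<noteq> j" for i j
    using that pos \<open>h > 0\<close>
    by (simp add: chang_cooper_def flip: \<beta>_def \<omega>_def)
  show "(\<Sum>j<N. ?A $$ (i, j)) = 0" if "i < N" for i
  proof -
    define l r where "l = (if i = 0 then N - 1 else i - 1)" and "r = (if i = N - 1 then 0 else i + 1)"
    have lr: "l < N" "r < N" "l \<noteq> i" "r \<noteq> i" "l \<noteq> r"
      using that \<open>N \<ge> 3\<close> by (auto simp: l_def r_def)
    have "?A $$ (i, j) = (if j = i then - \<beta> * (1 + \<omega>) / h else 0)
        + (if j = l then \<beta> / h else 0) + (if j = r then \<omega> * \<beta> / h else 0)" if "j < N" for j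
    proof -
      have "i = j + 1 \<or> (i = 0 \<and> j = N - 1) \<longleftrightarrow> j = l"
        "j = i + 1 \<or> (i = N - 1 \<and> j = 0) \<longleftrightarrow> j = r"
        using \<open>i < N\<close> \<open>j < N\<close> \<open>N \<ge> 3\<close> by (auto simp: l_def r_def)
      then show ?thesis
        using \<open>i < N\<close> \<open>j < N\<close> lr
        by (simp only: chang_cooper_def index_mat prod.case \<beta>_def \<omega>_def) auto
    qed
    then have "(\<Sum>j<N. ?A $$ (i, j)) = - \<beta> * (1 + \<omega>) / h + \<beta> / h + \<omega> * \<beta> / h"
      using that lr by (simp add: sum.distrib)
    also have "\<dots> = 0"
      using \<open>h > 0\<close> by (simp add: field_simps)
    finally show ?thesis .
  qed
qed

section \<open>Positivity of the BDF2 iterates\<close>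

theorem theorem2:
  fixes \<Omega>\<^sub>a \<Omega>\<^sub>b b \<sigma> h \<xi> :: real
    and N N\<^sub>\<Theta> :: nat
    and \<alpha> :: "nat \<Rightarrow> real"
    and \<rho> :: "nat \<Rightarrow> int"
    and A :: "real mat"
    and Q :: "real vec \<Rightarrow> real vec"
  assumes "\<Omega>\<^sub>a < \<Omega>\<^sub>b" and "\<sigma>\<^sup>2 > 0" and "N \<ge> 3" and "N\<^sub>\<Theta> \<ge> 1"
    and "h = (\<Omega>\<^sub>b - \<Omega>\<^sub>a) / real N"
    and "\<forall>j\<in>{1..N\<^sub>\<Theta>}. \<alpha> j \<ge> 0"
    and "grid_translation \<Omega>\<^sub>a h N \<rho>"
    and "A = chang_cooper N h (- b) (\<sigma>\<^sup>2 / 2)"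
    and "Q = jump_term \<Omega>\<^sub>a \<Omega>\<^sub>b N N\<^sub>\<Theta> h \<rho> \<alpha>"
    and "1 < \<xi>" and "\<xi> < 3"
  shows "\<exists>\<delta>\<^sub>0>0. \<forall>(T::real) (N\<^sub>T::nat) (\<delta>t::real) (\<tau>::real) (n::nat)
           (f :: nat \<Rightarrow> real vec) (g :: nat \<Rightarrow> real vec).
           T > 0 \<longrightarrow> N\<^sub>T \<ge> 1 \<longrightarrow> \<delta>t = T / real N\<^sub>T \<longrightarrow> \<delta>t \<le> \<delta>\<^sub>0 \<longrightarrow>
           0\<^sub>v N \<le> f 0 \<longrightarrow>
           0 < \<tau> \<longrightarrow> \<tau> \<le> \<delta>t \<longrightarrow> n \<ge> 1 \<longrightarrow>
           euler_scheme N A Q \<tau> n g \<longrightarrow> g 0 = f 0 \<longrightarrow> g n = f 1 \<longrightarrow>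
           0\<^sub>v N \<le> \<xi> \<cdot>\<^sub>v f 1 - f 0 \<longrightarrow>
           bdf2_scheme N A Q \<delta>t N\<^sub>T f \<longrightarrow>
           (\<forall>m. 1 < m \<and> m \<le> N\<^sub>T \<longrightarrow> 0\<^sub>v N \<le> f m)"
proof -
  define a where "a = jump_rate \<Omega>\<^sub>a \<Omega>\<^sub>b N N\<^sub>\<Theta> h \<alpha>"
  define d where "d = cc_beta h (- b) (\<sigma>\<^sup>2 / 2) * (1 + cc_omega h (- b) (\<sigma>\<^sup>2 / 2)) / h"
  have "h > 0"
    using assms by simp
  have gen: "generator_mat N A"
    using generator_mat_chang_cooper assms \<open>h > 0\<close> by simp
  have diag: "- d \<le> A $$ (i, i)" if "i < N" for i
    using that assms by (simp add: chang_cooper_def d_def)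
  have "d > 0"
    using cc_beta_pos[of h "\<sigma>\<^sup>2 / 2" "- b"] \<open>h > 0\<close> \<open>\<sigma>\<^sup>2 > 0\<close>
    by (simp add: d_def cc_omega_def add_pos_pos)
  then have "d \<ge> 0"
    by simp
  have "a \<ge> 0"
    using jump_rate_nonneg \<open>h > 0\<close> assms(6) by (simp add: a_def)
  have rate: "0 < \<xi> * a + 2 * d"
    using \<open>1 < \<xi>\<close> \<open>a \<ge> 0\<close> \<open>d > 0\<close> by (simp add: add_nonneg_pos)
  define \<delta>\<^sub>0 where "\<delta>\<^sub>0 = (\<xi> - 1) * (3 - \<xi>) / (\<xi> * a + 2 * d)"
  have "\<delta>\<^sub>0 > 0"
    using \<open>1 < \<xi>\<close> \<open>\<xi> < 3\<close> rate by (simp add: \<delta>\<^sub>0_def)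
  have main: "0\<^sub>v N \<le> f m"
    if "\<delta>t \<ge> 0" "\<delta>t \<le> \<delta>\<^sub>0" and f0: "0\<^sub>v N \<le> f 0" and f1: "0\<^sub>v N \<le> \<xi> \<cdot>\<^sub>v f 1 - f 0"
      and scheme: "bdf2_scheme N A Q \<delta>t N\<^sub>T f" and "1 < m" "m \<le> N\<^sub>T"
    for \<delta>t N\<^sub>T m and f :: "nat \<Rightarrow> real vec"
  proof -
    have carrier: "f l \<in> carrier_vec N" if "l \<le> N\<^sub>T" for l
      using scheme that by (simp add: bdf2_scheme_def)
    have small: "\<delta>t * (\<xi> * a + 2 * d) \<le> (\<xi> - 1) * (3 - \<xi>)"
      using \<open>\<delta>t \<le> \<delta>\<^sub>0\<close> rate by (simp add: \<delta>\<^sub>0_def pos_le_divide_eq)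
    have "l + 1 \<le> N\<^sub>T \<longrightarrow> (\<forall>i<N. 0 \<le> f (l + 1) $ i \<and> f l $ i \<le> \<xi> * f (l + 1) $ i)" for l
    proof (induction l)
      case 0
      show ?case
      proof (intro impI allI)
        fix i assume "0 + 1 \<le> N\<^sub>T" "i < N"
        then have "0 \<le> f 0 $ i" "f 0 $ i \<le> \<xi> * f 1 $ i"
          using f0 f1 carrier[of 0] carrier[of 1] by (simp_all add: zero_le_vec_iff[of _ N])
        moreover from this have "0 \<le> f 1 $ i"
          using \<open>1 < \<xi>\<close> zero_le_mult_iff[of \<xi> "f 1 $ i"] by linarith
        ultimately show "0 \<le> f (0 + 1) $ i \<and> f 0 $ i \<le> \<xi> * f (0 + 1) $ i"
          by simp
      qed
    next
      case (Suc l)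
      show ?case
      proof (intro impI allI)
        fix i assume le: "Suc l + 1 \<le> N\<^sub>T" and "i < N"
        have nonneg: "0 \<le> f (l + 1) $ j" and growth: "f l $ j \<le> \<xi> * f (l + 1) $ j"
          if "j < N" for j
          using Suc.IH le that by auto
        have c: "f l \<in> carrier_vec N" "f (l + 1) \<in> carrier_vec N" "f (Suc l + 1) \<in> carrier_vec N"
          using carrier le by auto
        have q: "Q (f (l + 1)) \<in> carrier_vec N"
          using assms(9) by (simp add: jump_term_def)
        have loss: "- a * f (l + 1) $ j \<le> Q (f (l + 1)) $ j" if "j < N" for j
          using jump_term_lower_bound \<open>h > 0\<close> assms(6,9) c(2) that nonneg
          by (simp add: a_def)
        have "l + 1 \<in> {1..<N\<^sub>T}"
          using le by simp
        then have step: "(3 \<cdot>\<^sub>m 1\<^sub>m N - (2 * \<delta>t) \<cdot>\<^sub>m A) *\<^sub>v f (Suc l + 1)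
            = 4 \<cdot>\<^sub>v f (l + 1) - f l + \<delta>t \<cdot>\<^sub>v Q (f (l + 1))"
          using scheme unfolding bdf2_scheme_def by fastforce
        have "\<xi> > 0"
          using \<open>1 < \<xi>\<close> by simp
        note bdf2_step_nonneg[OF gen diag \<open>d \<ge> 0\<close> c q nonneg growth loss \<open>\<xi> > 0\<close>
            \<open>\<delta>t \<ge> 0\<close> small step \<open>i < N\<close>]
        then show "0 \<le> f (Suc l + 1) $ i \<and> f (Suc l) $ i \<le> \<xi> * f (Suc l + 1) $ i"
          by simp
      qed
    qed
    from this[of "m - 1"] show ?thesis
      using \<open>1 < m\<close> \<open>m \<le> N\<^sub>T\<close> carrier[of m] by (simp add: zero_le_vec_iff[of _ N])
  qed
  show ?thesis
  proof (intro exI[of _ \<delta>\<^sub>0] conjI allI impI; (elim conjE)?)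
    show "\<delta>\<^sub>0 > 0" by fact
  next
    fix T :: real and N\<^sub>T :: nat and \<delta>t \<tau> :: real and n m :: nat and f g :: "nat \<Rightarrow> real vec"
    assume "0 < \<tau>" "\<tau> \<le> \<delta>t" "\<delta>t \<le> \<delta>\<^sub>0" "0\<^sub>v N \<le> f 0" "0\<^sub>v N \<le> \<xi> \<cdot>\<^sub>v f 1 - f 0"
      "bdf2_scheme N A Q \<delta>t N\<^sub>T f" "1 < m" "m \<le> N\<^sub>T"
    then show "0\<^sub>v N \<le> f m"
      by (intro main[of \<delta>t f N\<^sub>T m]) auto
  qed
qed

end
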